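(* Let $L$ be a lattice that is isomorphic to a sublattice of a free lattice $FL(S)$ for some set $S$ (of arbitrary cardinality). If $L$ is locally finite, then $L$ is countable.
   Context: A lattice is a poset in which every nonempty finite subset has a greatest lower bound and a least upper bound; for two elements these are written $a \wedge b$ and $a \vee b$. Lattices are not required to have a least or greatest element. A sublattice of a lattice $K$ is a subset closed under the binary operations $\vee$ and $\wedge$ of $K$, with the induced order. A lattice homomorphism is a map preserving binary joins and binary meets (it need not preserve any bounds); two lattices are isomorphic if there are mutually inverse bijective lattice homomorphisms between them. For a set $S$, the free lattice $FL(S)$ is the lattice containing $S$ (unique up to isomorphism) such that for every lattice $K$ and every function $f : S \to K$ there is a unique lattice homomorphism $g : FL(S) \to K$ with $g(s) = f(s)$ for all $s \in S$. A poset $P$ is locally finite if for all $a, b \in P$ with $a \leq b$, the interval $[a,b] = \{c \in P : a \leq c \leq b\}$ is finite. "Countable" means finite or countably infinite. The ambient set theory is ZFC. *)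

theory Defs
  imports "HOL-Algebra.Lattice" "HOL-Library.Countable_Set"
begin

section \<open>Sublattices, lattice homomorphisms and isomorphisms\<close>

definition sublattice :: "'a set \<Rightarrow> ('a, 'b) gorder_scheme \<Rightarrow> bool" where
  "sublattice M K \<longleftrightarrow>
     M \<subseteq> carrier K \<and> (\<forall>x\<in>M. \<forall>y\<in>M. x \<squnion>\<^bsub>K\<^esub> y \<in> M \<and> x \<sqinter>\<^bsub>K\<^esub> y \<in> M)"

lemma sublattice_lattice:
  assumes "lattice K" "sublattice M K"
  shows "lattice (K\<lparr>carrier := M\<rparr>)"
    and "x \<in> M \<Longrightarrow> y \<in> M \<Longrightarrow> x \<squnion>\<^bsub>K\<lparr>carrier := M\<rparr>\<^esub> y = x \<squnion>\<^bsub>K\<^esub> y"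
    and "x \<in> M \<Longrightarrow> y \<in> M \<Longrightarrow> x \<sqinter>\<^bsub>K\<lparr>carrier := M\<rparr>\<^esub> y = x \<sqinter>\<^bsub>K\<^esub> y"
proof -
  let ?M = "K\<lparr>carrier := M\<rparr>"
  interpret K: lattice K by fact
  have sub: "M \<subseteq> carrier K"
    and cl: "\<And>x y. x \<in> M \<Longrightarrow> y \<in> M \<Longrightarrow> x \<squnion>\<^bsub>K\<^esub> y \<in> M \<and> x \<sqinter>\<^bsub>K\<^esub> y \<in> M"
    using assms(2) by (auto simp: sublattice_def)
  interpret weak_partial_order ?M
    using weak_partial_order_subset[of K M] K.weak_partial_order_axioms sub by simp
  interpret partial_order ?M
    by unfold_locales (simp add: K.eq_is_equal)
  have least: "least ?M (x \<squnion>\<^bsub>K\<^esub> y) (Upper ?M {x, y})" if xy: "x \<in> M" "y \<in> M" for x y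
  proof (rule least_UpperI)
    show "z \<sqsubseteq>\<^bsub>?M\<^esub> x \<squnion>\<^bsub>K\<^esub> y" if "z \<in> {x, y}" for z
      using that xy sub K.join_left[of x y] K.join_right[of x y] by (auto simp: subset_iff)
    show "x \<squnion>\<^bsub>K\<^esub> y \<sqsubseteq>\<^bsub>?M\<^esub> z" if "z \<in> Upper ?M {x, y}" for z
      using that xy sub K.join_le[of x z y] by (simp add: Upper_def subset_iff)
  qed (use xy cl in auto)
  have greatest: "greatest ?M (x \<sqinter>\<^bsub>K\<^esub> y) (Lower ?M {x, y})" if xy: "x \<in> M" "y \<in> M" for x y
  proof (rule greatest_LowerI)
    show "x \<sqinter>\<^bsub>K\<^esub> y \<sqsubseteq>\<^bsub>?M\<^esub> z" if "z \<in> {x, y}" for z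
      using that xy sub K.meet_left[of x y] K.meet_right[of x y] by (auto simp: subset_iff)
    show "z \<sqsubseteq>\<^bsub>?M\<^esub> x \<sqinter>\<^bsub>K\<^esub> y" if "z \<in> Lower ?M {x, y}" for z
      using that xy sub K.meet_le[of z x y] by (simp add: Lower_def subset_iff)
  qed (use xy cl in auto)
  interpret M: lattice ?M
  proof
    fix x y assume "x \<in> carrier ?M" "y \<in> carrier ?M"
    then show "\<exists>s. least ?M s (Upper ?M {x, y})" "\<exists>s. greatest ?M s (Lower ?M {x, y})"
      using least[of x y] greatest[of x y] by auto
  qed
  show "lattice ?M" by (rule M.lattice_axioms)
  show "x \<squnion>\<^bsub>?M\<^esub> y = x \<squnion>\<^bsub>K\<^esub> y" if "x \<in> M" "y \<in> M"
    unfolding join_def[of ?M]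
    by (rule least_unique[OF M.sup_of_two_least least]) (use that in auto)
  show "x \<sqinter>\<^bsub>?M\<^esub> y = x \<sqinter>\<^bsub>K\<^esub> y" if "x \<in> M" "y \<in> M"
    unfolding meet_def[of ?M]
    by (rule greatest_unique[OF M.inf_of_two_greatest greatest]) (use that in auto)
qed

definition lattice_hom ::
  "('a, 'c) gorder_scheme \<Rightarrow> ('b, 'd) gorder_scheme \<Rightarrow> ('a \<Rightarrow> 'b) set" where
  "lattice_hom K K' =
     {h. h \<in> carrier K \<rightarrow> carrier K' \<and> join_pres K K' h \<and> meet_pres K K' h}"

definition lattice_isomorphic ::
  "('a, 'c) gorder_scheme \<Rightarrow> ('b, 'd) gorder_scheme \<Rightarrow> bool" where
  "lattice_isomorphic K K' \<longleftrightarrow>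
     (\<exists>g\<in>lattice_hom K K'. \<exists>h\<in>lattice_hom K' K.
        (\<forall>x\<in>carrier K. h (g x) = x) \<and> (\<forall>y\<in>carrier K'. g (h y) = y))"

definition locally_finite :: "('a, 'b) gorder_scheme \<Rightarrow> bool" where
  "locally_finite P \<longleftrightarrow>
     (\<forall>a\<in>carrier P. \<forall>b\<in>carrier P. a \<sqsubseteq>\<^bsub>P\<^esub> b \<longrightarrow> finite \<lbrace>a..b\<rbrace>\<^bsub>P\<^esub>)"


section \<open>Free lattices\<close>

datatype (gens: 's) lat_term =
    Gen 's
  | Join "'s lat_term" "'s lat_term"
  | Meet "'s lat_term" "'s lat_term"

text \<open>The least preorder on terms for which \<^const>\<open>Join\<close> is a least upper bound and
  \<^const>\<open>Meet\<close> a greatest lower bound.\<close>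

inductive term_le :: "'s lat_term \<Rightarrow> 's lat_term \<Rightarrow> bool" where
  refl: "term_le t t"
| trans: "term_le t u \<Longrightarrow> term_le u v \<Longrightarrow> term_le t v"
| join_upper1: "term_le t (Join t u)"
| join_upper2: "term_le u (Join t u)"
| join_least: "term_le t v \<Longrightarrow> term_le u v \<Longrightarrow> term_le (Join t u) v"
| meet_lower1: "term_le (Meet t u) t"
| meet_lower2: "term_le (Meet t u) u"
| meet_greatest: "term_le v t \<Longrightarrow> term_le v u \<Longrightarrow> term_le v (Meet t u)"

definition term_equiv :: "'s lat_term \<Rightarrow> 's lat_term \<Rightarrow> bool" where
  "term_equiv t u \<longleftrightarrow> term_le t u \<and> term_le u t"

quotient_type 's free_lat = "'s lat_term" / term_equiv
proof (rule equivpI)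
  show "reflp term_equiv"
    by (rule reflpI) (simp add: term_equiv_def term_le.refl)
  show "symp term_equiv"
    by (rule sympI) (simp add: term_equiv_def)
  show "transp term_equiv"
    unfolding term_equiv_def transp_def by (meson term_le.trans)
qed

lift_definition free_le :: "'s free_lat \<Rightarrow> 's free_lat \<Rightarrow> bool" is term_le
  unfolding term_equiv_def by (blast intro: term_le.trans)

lift_definition free_gen :: "'s \<Rightarrow> 's free_lat" is Gen .

text \<open>The free lattice on an arbitrary, possibly empty, set \<open>S\<close>: the classes of the terms
  over \<open>S\<close>. The lemmas \<open>lattice_free_lattice\<close>, \<open>inj_free_gen\<close>, \<open>free_gen_closed\<close> and
  \<open>free_lattice_universal\<close> below show that it is a lattice containing a copy of \<open>S\<close> with the
  universal property that characterises the free lattice up to isomorphism.\<close>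

definition free_lattice :: "'s set \<Rightarrow> 's free_lat gorder" where
  "free_lattice S =
     \<lparr>carrier = abs_free_lat ` {t. gens t \<subseteq> S}, eq = (=), le = free_le\<rparr>"

lemma free_le_abs: "free_le (abs_free_lat t) (abs_free_lat u) \<longleftrightarrow> term_le t u"
  by (rule free_le.abs_eq)

lemma abs_eq: "abs_free_lat t = abs_free_lat u \<longleftrightarrow> term_equiv t u"
  by (rule free_lat.abs_eq_iff)

lemma free_gen_closed: "s \<in> S \<Longrightarrow> free_gen s \<in> carrier (free_lattice S)"
  by (auto simp: free_lattice_def free_gen.abs_eq)

lemma abs_closed: "gens t \<subseteq> S \<Longrightarrow> abs_free_lat t \<in> carrier (free_lattice S)"
  by (auto simp: free_lattice_def)

lemma free_le_refl: "free_le x x"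
  by transfer (rule term_le.refl)

lemma free_le_antisym: "free_le x y \<Longrightarrow> free_le y x \<Longrightarrow> x = y"
  by transfer (simp add: term_equiv_def)

lemma free_le_trans: "free_le x y \<Longrightarrow> free_le y z \<Longrightarrow> free_le x z"
  by transfer (rule term_le.trans)

lemma partial_order_free_lattice: "partial_order (free_lattice S)"
  by unfold_locales
    (auto simp: free_lattice_def intro: free_le_refl free_le_antisym free_le_trans)

lemma least_join:
  assumes "gens t \<subseteq> S" "gens u \<subseteq> S"
  shows "least (free_lattice S) (abs_free_lat (Join t u))
           (Upper (free_lattice S) {abs_free_lat t, abs_free_lat u})"
  using assms
  by (auto simp: least_def Upper_def free_lattice_def free_le_abs all_conj_distrib
      intro: term_le.join_upper1 term_le.join_upper2 term_le.join_least)

lemma greatest_meet: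
  assumes "gens t \<subseteq> S" "gens u \<subseteq> S"
  shows "greatest (free_lattice S) (abs_free_lat (Meet t u))
           (Lower (free_lattice S) {abs_free_lat t, abs_free_lat u})"
  using assms
  by (auto simp: greatest_def Lower_def free_lattice_def free_le_abs all_conj_distrib
      intro: term_le.meet_lower1 term_le.meet_lower2 term_le.meet_greatest)

lemma carrier_free_latticeE:
  assumes "x \<in> carrier (free_lattice S)"
  obtains t where "x = abs_free_lat t" "gens t \<subseteq> S"
  using assms by (auto simp: free_lattice_def)

theorem lattice_free_lattice: "lattice (free_lattice S)"
proof -
  interpret partial_order "free_lattice S" by (rule partial_order_free_lattice)
  show ?thesis
  proof
    fix x y
    assume "x \<in> carrier (free_lattice S)" "y \<in> carrier (free_lattice S)"
    then obtain t u where "x = abs_free_lat t" "gens t \<subseteq> S" "y = abs_free_lat u" "gens u \<subseteq> S"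
      by (metis carrier_free_latticeE)
    then show "\<exists>s. least (free_lattice S) s (Upper (free_lattice S) {x, y})"
      and "\<exists>s. greatest (free_lattice S) s (Lower (free_lattice S) {x, y})"
      using least_join greatest_meet by blast+
  qed
qed

lemma join_abs:
  assumes "gens t \<subseteq> S" "gens u \<subseteq> S"
  shows "abs_free_lat t \<squnion>\<^bsub>free_lattice S\<^esub> abs_free_lat u = abs_free_lat (Join t u)"
proof -
  interpret lattice "free_lattice S" by (rule lattice_free_lattice)
  show ?thesis
    unfolding join_def
    by (rule least_unique[OF sup_of_two_least least_join]) (use assms in \<open>auto intro: abs_closed\<close>)
qed

lemma meet_abs:
  assumes "gens t \<subseteq> S" "gens u \<subseteq> S"
  shows "abs_free_lat t \<sqinter>\<^bsub>free_lattice S\<^esub> abs_free_lat u = abs_free_lat (Meet t u)"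
proof -
  interpret lattice "free_lattice S" by (rule lattice_free_lattice)
  show ?thesis
    unfolding meet_def
    by (rule greatest_unique[OF inf_of_two_greatest greatest_meet]) (use assms in \<open>auto intro: abs_closed\<close>)
qed

primrec term_eval :: "('k, 'm) gorder_scheme \<Rightarrow> ('s \<Rightarrow> 'k) \<Rightarrow> 's lat_term \<Rightarrow> 'k" where
  "term_eval K f (Gen s) = f s"
| "term_eval K f (Join t u) = term_eval K f t \<squnion>\<^bsub>K\<^esub> term_eval K f u"
| "term_eval K f (Meet t u) = term_eval K f t \<sqinter>\<^bsub>K\<^esub> term_eval K f u"

lemma term_eval_closed:
  assumes "lattice K" "f ` gens t \<subseteq> carrier K"
  shows "term_eval K f t \<in> carrier K"
proof -
  interpret lattice K by fact
  show ?thesis using assms(2) by (induction t) (simp_all add: image_Un)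
qed

lemma term_eval_mono:
  assumes "lattice K" "range f \<subseteq> carrier K" "term_le t u"
  shows "term_eval K f t \<sqsubseteq>\<^bsub>K\<^esub> term_eval K f u"
proof -
  interpret lattice K by fact
  have cl: "term_eval K f t \<in> carrier K" for t
    using assms(1,2) by (intro term_eval_closed) auto
  show ?thesis
    using assms(3)
  proof induction
    case (trans t u v)
    then show ?case by (blast intro: le_trans[OF _ _ cl cl cl])
  qed (simp_all add: cl join_left join_right join_le meet_left meet_right meet_le)
qed

lemma term_eval_cong:
  "(\<And>s. s \<in> gens t \<Longrightarrow> f s = g s) \<Longrightarrow> term_eval K f t = term_eval K g t"
  by (induction t) auto

lemma term_eval_equiv:
  assumes K: "lattice K" and f: "f \<in> S \<rightarrow> carrier K"
    and t: "gens t \<subseteq> S" and u: "gens u \<subseteq> S" and eq: "term_equiv t u"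
  shows "term_eval K f t = term_eval K f u"
proof -
  interpret lattice K by fact
  have "gens t \<noteq> {}" by (induction t) auto
  then obtain s0 where s0: "s0 \<in> S" using t by auto
  define f' where "f' s = (if s \<in> S then f s else f s0)" for s
  have f': "range f' \<subseteq> carrier K"
    using f s0 by (auto simp: f'_def)
  have cl: "term_eval K f' t \<in> carrier K" for t
    using K f' by (intro term_eval_closed) auto
  have "term_eval K f' t = term_eval K f' u"
    using term_eval_mono[OF K f'] eq cl unfolding term_equiv_def
    by (meson le_antisym)
  moreover have "term_eval K f' t = term_eval K f t" "term_eval K f' u = term_eval K f u"
    using t u by (auto simp: f'_def intro!: term_eval_cong)
  ultimately show ?thesis by simp
qed

theorem free_lattice_universal:
  assumes K: "lattice K" and f: "f \<in> S \<rightarrow> carrier K"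
  shows "\<exists>!g. g \<in> extensional (carrier (free_lattice S)) \<and>
    g \<in> lattice_hom (free_lattice S) K \<and> (\<forall>s\<in>S. g (free_gen s) = f s)"
proof -
  let ?F = "free_lattice S"
  define g where "g = restrict
    (\<lambda>x. term_eval K f (SOME t. gens t \<subseteq> S \<and> x = abs_free_lat t)) (carrier ?F)"
  have g: "g (abs_free_lat t) = term_eval K f t" if t: "gens t \<subseteq> S" for t
  proof -
    let ?t = "SOME u. gens u \<subseteq> S \<and> abs_free_lat t = abs_free_lat u"
    have "gens ?t \<subseteq> S \<and> abs_free_lat t = abs_free_lat ?t"
      by (rule someI[of _ t]) (use t in auto)
    then have "term_eval K f t = term_eval K f ?t"
      using term_eval_equiv[OF K f t] by (simp add: abs_eq)
    then show ?thesis using abs_closed[OF t] by (simp add: g_def)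
  qed
  have g_cl: "g \<in> carrier ?F \<rightarrow> carrier K"
  proof
    fix x assume "x \<in> carrier ?F"
    then obtain t where t: "x = abs_free_lat t" "gens t \<subseteq> S" by (rule carrier_free_latticeE)
    with f show "g x \<in> carrier K"
      by (auto simp: g intro!: term_eval_closed[OF K])
  qed
  have "join_pres ?F K g"
    unfolding join_pres_def using K lattice_free_lattice
    by (auto elim!: carrier_free_latticeE simp: join_abs g)
  moreover have "meet_pres ?F K g"
    unfolding meet_pres_def using K lattice_free_lattice
    by (auto elim!: carrier_free_latticeE simp: meet_abs g)
  ultimately have hom: "g \<in> lattice_hom ?F K"
    using g_cl by (simp add: lattice_hom_def)
  have uniq: "h (abs_free_lat t) = term_eval K f t"
    if h: "h \<in> lattice_hom ?F K" "\<forall>s\<in>S. h (free_gen s) = f s" and t: "gens t \<subseteq> S" for h t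
    using t
  proof (induction t)
    case (Gen s)
    then show ?case using h(2) by (simp add: free_gen.abs_eq)
  next
    case (Join t u)
    then have "h (abs_free_lat t \<squnion>\<^bsub>?F\<^esub> abs_free_lat u) = h (abs_free_lat t) \<squnion>\<^bsub>K\<^esub> h (abs_free_lat u)"
      using h(1) by (simp add: lattice_hom_def join_pres_def abs_closed)
    with Join show ?case by (simp add: join_abs)
  next
    case (Meet t u)
    then have "h (abs_free_lat t \<sqinter>\<^bsub>?F\<^esub> abs_free_lat u) = h (abs_free_lat t) \<sqinter>\<^bsub>K\<^esub> h (abs_free_lat u)"
      using h(1) by (simp add: lattice_hom_def meet_pres_def abs_closed)
    with Meet show ?case by (simp add: meet_abs)
  qed
  show ?thesis
  proof (rule ex1I[of _ g])
    show "g \<in> extensional (carrier ?F) \<and> g \<in> lattice_hom ?F K \<and> (\<forall>s\<in>S. g (free_gen s) = f s)"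
      using hom by (auto simp: free_gen.abs_eq g) (simp add: g_def)
    fix h assume h: "h \<in> extensional (carrier ?F) \<and> h \<in> lattice_hom ?F K \<and> (\<forall>s\<in>S. h (free_gen s) = f s)"
    show "h = g"
    proof (rule extensionalityI)
      show "h \<in> extensional (carrier ?F)" using h by blast
      show "g \<in> extensional (carrier ?F)" by (simp add: g_def)
      fix x assume "x \<in> carrier ?F"
      then show "h x = g x" using h uniq g by (auto elim!: carrier_free_latticeE)
    qed
  qed
qed

theorem inj_free_gen: "inj free_gen"
proof (rule injI, rule ccontr)
  fix a b :: 'a assume eq: "free_gen a = free_gen b" and "a \<noteq> b"
  let ?K = "\<lparr>carrier = UNIV, eq = (=), le = (\<le>)\<rparr> :: bool gorder"
  interpret total_order ?K by unfold_locales auto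
  have "lattice ?K" by (rule lattice_axioms)
  then have "term_eval ?K (\<lambda>s. s = a) (Gen a) = term_eval ?K (\<lambda>s. s = a) (Gen b)"
    by (rule term_eval_equiv[where S = UNIV])
      (use eq in \<open>auto simp: free_gen.abs_eq abs_eq\<close>)
  with \<open>a \<noteq> b\<close> show False by simp
qed

end

theory Submission
  imports Defs
begin

text \<open>
  An uncountable sublattice contains, by a sunflower argument on the generators of representing
  terms of one fixed shape, an infinite sequence \<open>x\<close> of distinct elements on which every
  \<open>r : \<nat> \<rightarrow> \<nat>\<close> acts through a substitution of generators. Finiteness of the interval between
  \<open>x\<^sub>0 \<and> x\<^sub>1\<close> and \<open>x\<^sub>0\<close> makes two of the elements \<open>(x\<^sub>0 \<and> x\<^sub>1) \<or> (x\<^sub>0 \<and> x\<^sub>i)\<close> equal; Whitman's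
  condition and the choice of a shortest term for \<open>x\<^sub>0\<close> then give \<open>x\<^sub>k \<and> x\<^sub>l \<le> x\<^sub>m\<close> for all distinct
  indices. With the dual inequalities, \<open>x\<^sub>0, x\<^sub>1, x\<^sub>2\<close> have equal pairwise meets and equal pairwise
  joins, which contradicts the semidistributivity of free lattices.
\<close>

text \<open>Shapes of terms will be terms over \<open>nat\<close>; being countably many, they leave
  some shape with an uncountable fibre.\<close>

instance lat_term :: (countable) countable
  by countable_datatype

section \<open>Whitman's condition\<close>

text \<open>A cut-free calculus for the order: there is no transitivity rule and premises only
  involve subterms of the conclusion, so derivations can be inverted.\<close>

inductive whitman_le :: "'s lat_term \<Rightarrow> 's lat_term \<Rightarrow> bool" where
  gen: "whitman_le (Gen s) (Gen s)"
| join_left: "whitman_le t v \<Longrightarrow> whitman_le u v \<Longrightarrow> whitman_le (Join t u) v"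
| meet_right: "whitman_le v t \<Longrightarrow> whitman_le v u \<Longrightarrow> whitman_le v (Meet t u)"
| join_right1: "whitman_le v t \<Longrightarrow> whitman_le v (Join t u)"
| join_right2: "whitman_le v u \<Longrightarrow> whitman_le v (Join t u)"
| meet_left1: "whitman_le t v \<Longrightarrow> whitman_le (Meet t u) v"
| meet_left2: "whitman_le u v \<Longrightarrow> whitman_le (Meet t u) v"

lemma whitman_le_refl: "whitman_le t t"
  by (induction t) (auto intro: whitman_le.intros)

lemma whitman_le_JoinD: "whitman_le (Join t u) v \<Longrightarrow> whitman_le t v \<and> whitman_le u v"
  by (induction "Join t u" v rule: whitman_le.induct) (auto intro: whitman_le.intros)

lemma whitman_le_MeetD: "whitman_le v (Meet t u) \<Longrightarrow> whitman_le v t \<and> whitman_le v u"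
  by (induction v "Meet t u" rule: whitman_le.induct) (auto intro: whitman_le.intros)

text \<open>Cut elimination by induction on the middle term. An inner induction follows the left
  derivation for a generator or a join and the right one for a meet; for joins and meets the other
  inequality is split by inversion.\<close>

lemma whitman_le_trans: "whitman_le t u \<Longrightarrow> whitman_le u v \<Longrightarrow> whitman_le t v"
proof (induction u arbitrary: t v)
  case (Gen s)
  from Gen(1) show ?case
    by (induction t "Gen s" rule: whitman_le.induct) (auto intro: whitman_le.intros Gen(2))
next
  case (Join a b)
  from Join.prems(1) show ?case
    by (induction t "Join a b" rule: whitman_le.induct)
      (use Join.IH whitman_le_JoinD[OF Join.prems(2)] in \<open>blast intro: whitman_le.intros\<close>)+
next
  case (Meet a b)
  from Meet.prems(2) show ?case
    by (induction "Meet a b" v rule: whitman_le.induct)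
      (use Meet.IH whitman_le_MeetD[OF Meet.prems(1)] in \<open>blast intro: whitman_le.intros\<close>)+
qed

lemma term_le_iff_whitman_le: "term_le t u \<longleftrightarrow> whitman_le t u"
proof
  show "term_le t u \<Longrightarrow> whitman_le t u"
    by (induction rule: term_le.induct)
      (blast intro: whitman_le.intros whitman_le_refl whitman_le_trans)+
  show "whitman_le t u \<Longrightarrow> term_le t u"
    by (induction rule: whitman_le.induct) (blast intro: term_le.intros)+
qed

text \<open>Only the two left rules for meets and the two right rules for joins can end such a
  derivation.\<close>

lemma Meet_le_JoinD:
  assumes "term_le (Meet a b) (Join c d)"
  shows "term_le a (Join c d) \<or> term_le b (Join c d) \<or> term_le (Meet a b) c \<or> term_le (Meet a b) d"
  using assms unfolding term_le_iff_whitman_le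
  by (cases rule: whitman_le.cases) auto

lemma Gen_le_JoinD: "term_le (Gen s) (Join c d) \<Longrightarrow> term_le (Gen s) c \<or> term_le (Gen s) d"
  unfolding term_le_iff_whitman_le by (cases rule: whitman_le.cases) auto

lemma Join_le_iff: "term_le (Join t u) v \<longleftrightarrow> term_le t v \<and> term_le u v"
  by (meson term_le.intros)

lemma le_Meet_iff: "term_le v (Meet t u) \<longleftrightarrow> term_le v t \<and> term_le v u"
  by (meson term_le.intros)

lemma le_JoinI1: "term_le v t \<Longrightarrow> term_le v (Join t u)"
  by (meson term_le.intros)

lemma le_JoinI2: "term_le v u \<Longrightarrow> term_le v (Join t u)"
  by (meson term_le.intros)

lemma Meet_leI1: "term_le t v \<Longrightarrow> term_le (Meet t u) v"
  by (meson term_le.intros)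

lemma Meet_leI2: "term_le u v \<Longrightarrow> term_le (Meet t u) v"
  by (meson term_le.intros)

section \<open>Duality and substitution\<close>

primrec dual_term :: "'s lat_term \<Rightarrow> 's lat_term" where
  "dual_term (Gen s) = Gen s"
| "dual_term (Join t u) = Meet (dual_term t) (dual_term u)"
| "dual_term (Meet t u) = Join (dual_term t) (dual_term u)"

lemma dual_dual_term [simp]: "dual_term (dual_term t) = t"
  by (induction t) auto

lemma size_dual_term [simp]: "size (dual_term t) = size t"
  by (induction t) auto

lemma map_dual_term: "map_lat_term f (dual_term t) = dual_term (map_lat_term f t)"
  by (induction t) auto

lemma dual_term_le: "term_le t u \<Longrightarrow> term_le (dual_term u) (dual_term t)"
  by (induction rule: term_le.induct) (auto intro: term_le.intros)

lemma dual_term_le_iff: "term_le (dual_term t) (dual_term u) \<longleftrightarrow> term_le u t"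
  using dual_term_le[of u t] dual_term_le[of "dual_term t" "dual_term u"] by auto

lemma map_term_le: "term_le t u \<Longrightarrow> term_le (map_lat_term f t) (map_lat_term f u)"
  by (induction rule: term_le.induct) (auto intro: term_le.intros)

lemma map_lat_term_fixed:
  "map_lat_term f t = t \<Longrightarrow> s \<in> gens t \<Longrightarrow> f s = s"
  by (induction t) auto

lemma finite_gens: "finite (gens t)"
  by (induction t) auto

section \<open>Terms of minimal size\<close>

primrec joinands :: "'s lat_term \<Rightarrow> 's lat_term set" where
  "joinands (Gen s) = {Gen s}"
| "joinands (Join t u) = joinands t \<union> joinands u"
| "joinands (Meet t u) = {Meet t u}"

lemma le_iff_joinands: "term_le t v \<longleftrightarrow> (\<forall>p\<in>joinands t. term_le p v)"
  by (induction t) (auto simp: Join_le_iff)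

lemma gens_joinands: "p \<in> joinands t \<Longrightarrow> gens p \<subseteq> gens t"
  by (induction t) auto

lemma joinands_not_Join: "p \<in> joinands t \<Longrightarrow> p \<noteq> Join c d"
  by (induction t) auto

text \<open>\<open>x'\<close> is \<open>x\<close> with one occurrence of \<open>p\<close> replaced
  by \<open>c\<close>. The last conjunct bounds \<open>x'\<close> by the join of \<open>x\<close>
  and \<open>c\<close>, so \<open>x'\<close> is equivalent to \<open>x\<close> once \<open>c\<close>
  lies under \<open>x\<close>.\<close>

lemma replace_joinand:
  assumes "p \<in> joinands x" "term_le p c" "size c < size p"
  shows "\<exists>x'. size x' < size x \<and> term_le x x' \<and>
           (\<forall>v. term_le x v \<longrightarrow> term_le c v \<longrightarrow> term_le x' v)"
  using assms(1)
proof (induction x)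
  case (Join t u)
  then consider "p \<in> joinands t" | "p \<in> joinands u" by auto
  then show ?case
  proof cases
    case 1
    with Join obtain t' where "size t' < size t" "term_le t t'"
      "\<forall>v. term_le t v \<longrightarrow> term_le c v \<longrightarrow> term_le t' v" by blast
    then show ?thesis
      by (intro exI[of _ "Join t' u"])
        (auto simp: Join_le_iff intro: le_JoinI1 le_JoinI2 term_le.refl)
  next
    case 2
    with Join obtain u' where "size u' < size u" "term_le u u'"
      "\<forall>v. term_le u v \<longrightarrow> term_le c v \<longrightarrow> term_le u' v" by blast
    then show ?thesis
      by (intro exI[of _ "Join t u'"])
        (auto simp: Join_le_iff intro: le_JoinI1 le_JoinI2 term_le.refl)
  qed
qed (use assms in auto)

definition minimal_term :: "'s lat_term \<Rightarrow> bool" where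
  "minimal_term t \<longleftrightarrow> (\<forall>u. term_equiv u t \<longrightarrow> size t \<le> size u)"

lemma minimal_term_ex: "\<exists>u. term_equiv u t \<and> minimal_term u"
proof -
  have "term_equiv t t" by (simp add: term_equiv_def term_le.refl)
  from ex_has_least_nat[of "\<lambda>u. term_equiv u t", OF this, of size]
  obtain u where "term_equiv u t" "\<And>w. term_equiv w t \<Longrightarrow> size u \<le> size w" by auto
  then show ?thesis
    unfolding minimal_term_def term_equiv_def by (meson term_le.trans)
qed

lemma minimal_term_dual: "minimal_term t \<Longrightarrow> minimal_term (dual_term t)"
  unfolding minimal_term_def term_equiv_def
  by (metis dual_dual_term dual_term_le size_dual_term)

text \<open>If a meet among the joinands lies under neither \<open>a\<close> nor \<open>b\<close>, Whitman's condition
  puts one of its factors under \<open>x\<close>, and this factor can replace it in \<open>x\<close>, giving a smaller term.\<close>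

lemma minimal_joinands_refine:
  assumes min: "minimal_term x" and eq: "term_equiv x (Join a b)" and p: "p \<in> joinands x"
  shows "term_le p a \<or> term_le p b"
proof (rule ccontr)
  assume neg: "\<not> ?thesis"
  have px: "term_le p x" using le_iff_joinands[of x x] p term_le.refl by blast
  then have pj: "term_le p (Join a b)" using eq by (meson term_equiv_def term_le.trans)
  obtain c d where p_eq: "p = Meet c d"
  proof (cases p)
    case (Gen s)
    with neg pj Gen_le_JoinD[of s a b] show ?thesis by blast
  next
    case (Join c d)
    with joinands_not_Join[OF p] show ?thesis by blast
  next
    case (Meet c d)
    then show ?thesis by (rule that)
  qed
  obtain e where e: "term_le e (Join a b)" "term_le p e" "size e < size p"
  proof -
    have "term_le c (Join a b) \<or> term_le d (Join a b)"
      using Meet_le_JoinD[of c d a b] pj neg by (auto simp: p_eq)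
    then show thesis
      using that[of c] that[of d]
      by (auto simp: p_eq intro: term_le.meet_lower1 term_le.meet_lower2)
  qed
  then have "term_le e x" using eq by (meson term_equiv_def term_le.trans)
  with replace_joinand[OF p e(2,3)] obtain x' where "size x' < size x" "term_equiv x' x"
    unfolding term_equiv_def by (meson term_le.refl)
  with min show False by (auto simp: minimal_term_def)
qed

text \<open>Each joinand of a shortest term for the common join lies under \<open>a\<close> or
  \<open>b\<close>, and under \<open>a\<close> or \<open>c\<close>; hence under \<open>a\<close>, or
  under both \<open>b\<close> and \<open>c\<close>.\<close>

theorem join_semidistributive:
  assumes "term_equiv (Join a b) (Join a c)"
  shows "term_le (Join a b) (Join a (Meet b c))"
proof -
  obtain u where u: "term_equiv u (Join a b)" "minimal_term u"
    using minimal_term_ex by blast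
  with assms have u': "term_equiv u (Join a c)"
    unfolding term_equiv_def by (meson term_le.trans)
  have "term_le p (Join a (Meet b c))" if "p \<in> joinands u" for p
    using minimal_joinands_refine[OF u(2,1) that] minimal_joinands_refine[OF u(2) u' that]
    by (auto intro: le_JoinI1 le_JoinI2 simp: le_Meet_iff)
  then have "term_le u (Join a (Meet b c))" by (simp add: le_iff_joinands[of u])
  with u show ?thesis unfolding term_equiv_def by (meson term_le.trans)
qed

section \<open>Indiscernible sequences\<close>

text \<open>Index maps that identify indices are included, so an inequality among the
  \<open>x i\<close> survives merging indices as well as permuting them.\<close>

definition indiscernible :: "(nat \<Rightarrow> 's lat_term) \<Rightarrow> bool" where
  "indiscernible x \<longleftrightarrow> (\<forall>r. \<exists>\<theta>. \<forall>i. map_lat_term \<theta> (x i) = x (r i))"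

lemma indiscernibleE:
  assumes "indiscernible x"
  obtains \<theta> where "\<And>i. map_lat_term \<theta> (x i) = x (r i)"
proof -
  from assms have "\<exists>\<theta>. \<forall>i. map_lat_term \<theta> (x i) = x (r i)"
    unfolding indiscernible_def by (rule spec)
  then show thesis using that by auto
qed

lemma indiscernible_dual: "indiscernible x \<Longrightarrow> indiscernible (\<lambda>i. dual_term (x i))"
  unfolding indiscernible_def by (metis map_dual_term)

text \<open>Swapping \<open>i\<close> and \<open>j\<close> reverses the inequality, which would make
  the two terms equivalent.\<close>

lemma indiscernible_antichain:
  assumes ind: "indiscernible x" and ne: "\<And>i j. i \<noteq> j \<Longrightarrow> \<not> term_equiv (x i) (x j)"
    and "i \<noteq> j"
  shows "\<not> term_le (x i) (x j)"
proof
  assume le: "term_le (x i) (x j)"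
  obtain \<theta> where \<theta>: "\<And>k. map_lat_term \<theta> (x k) = x (if k = i then j else if k = j then i else k)"
    by (rule indiscernibleE[OF ind, of "\<lambda>k. if k = i then j else if k = j then i else k"]) blast
  from map_term_le[OF le, of \<theta>] have "term_le (x j) (x i)" using \<open>i \<noteq> j\<close> by (simp add: \<theta>)
  with le ne[OF \<open>i \<noteq> j\<close>] show False by (simp add: term_equiv_def)
qed

text \<open>Whitman's condition splits \<open>le\<close> into four cases. Neither \<open>x i\<close>
  nor \<open>x 0\<close> can lie under the join; the other two cases put the meet of
  \<open>x 0\<close> and \<open>x i\<close> under a third \<open>x n\<close>, and reindexing carries
  this to all distinct triples.\<close>

lemma indiscernible_meet_le:
  assumes ind: "indiscernible x"
    and anti: "\<And>i j. i \<noteq> j \<Longrightarrow> \<not> term_le (x i) (x j)"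
    and min: "minimal_term (x 0)"
    and ij: "distinct [0, 1, i, j]"
    and le: "term_le (Meet (x 0) (x i)) (Join (Meet (x 0) (x 1)) (Meet (x 0) (x j)))"
    and klm: "distinct [k, l, m]"
  shows "term_le (Meet (x k) (x l)) (x m)"
proof -
  let ?y = "\<lambda>i. Meet (x 0) (x i)" and ?J = "Join (Meet (x 0) (x 1)) (Meet (x 0) (x j))"
  have J0: "term_le ?J (x 0)" by (simp add: Join_le_iff term_le.meet_lower1)
  have "\<not> term_le (x i) ?J" using anti[of i 0] ij J0 by (auto intro: term_le.trans)
  moreover have "\<not> term_le (x 0) ?J"
  proof
    assume "term_le (x 0) ?J"
    \<comment> \<open>By minimality each joinand of \<open>x 0\<close> lies under one of the two
      meets, hence under \<open>x 1\<close> or \<open>x j\<close>. Merging \<open>j\<close> into 1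
      puts it under \<open>x 1\<close> in either case.\<close>
    with J0 have eq: "term_equiv (x 0) ?J" by (simp add: term_equiv_def)
    obtain \<theta> where \<theta>: "\<And>k. map_lat_term \<theta> (x k) = x (if k = j then 1 else k)"
      by (rule indiscernibleE[OF ind, of "\<lambda>k. if k = j then 1 else k"]) blast
    have "term_le p (x 1)" if p: "p \<in> joinands (x 0)" for p
    proof -
      \<comment> \<open>\<open>p\<close> contains only generators of \<open>x 0\<close>, all fixed
        by \<open>\<theta>\<close> because \<open>j\<close> is not 0.\<close>
      have "map_lat_term \<theta> (x 0) = x 0" using ij by (simp add: \<theta>)
      then have "\<theta> s = s" if "s \<in> gens p" for s
        using map_lat_term_fixed[of \<theta> "x 0" s] gens_joinands[OF p] that by auto
      then have \<theta>p: "map_lat_term \<theta> p = p"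
        by (simp cong: lat_term.map_cong_simp add: lat_term.map_ident)
      consider "term_le p (?y 1)" | "term_le p (?y j)"
        using minimal_joinands_refine[OF min eq p] by blast
      then show ?thesis
      proof cases
        case 2
        then have "term_le p (x j)" by (simp add: le_Meet_iff)
        from map_term_le[OF this, of \<theta>] show ?thesis by (simp add: \<theta> \<theta>p)
      qed (simp add: le_Meet_iff)
    qed
    then have "term_le (x 0) (x 1)" by (simp add: le_iff_joinands[of "x 0"])
    with anti[of 0 1] show False by simp
  qed
  ultimately have "term_le (?y i) (?y 1) \<or> term_le (?y i) (?y j)"
    using Meet_le_JoinD[OF le] by blast
  then obtain n where n: "n \<noteq> 0" "n \<noteq> i" "term_le (?y i) (x n)"
    using ij by (auto simp: le_Meet_iff)
  \<comment> \<open>\<open>n\<close> is 1 or \<open>j\<close>, so the default branch sends it to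
    \<open>m\<close>.\<close>
  obtain \<theta> where \<theta>: "\<And>q. map_lat_term \<theta> (x q) = x (if q = 0 then k else if q = i then l else m)"
    by (rule indiscernibleE[OF ind, of "\<lambda>q. if q = 0 then k else if q = i then l else m"]) blast
  from map_term_le[OF n(3), of \<theta>] show ?thesis using n ij by (simp add: \<theta>)
qed

lemma indiscernible_contradiction:
  assumes ind: "indiscernible x"
    and ne: "\<And>i j. i \<noteq> j \<Longrightarrow> \<not> term_equiv (x i) (x j)"
    and min: "minimal_term (x 0)"
    and ij: "distinct [0, 1, i, j]"
    and le: "term_le (Meet (x 0) (x i)) (Join (Meet (x 0) (x 1)) (Meet (x 0) (x j)))"
    and ij': "distinct [0, 1, i', j']"
    and le': "term_le (Meet (Join (x 0) (x 1)) (Join (x 0) (x j'))) (Join (x 0) (x i'))"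
  shows False
proof -
  note anti = indiscernible_antichain[OF ind ne]
  have meet: "term_le (Meet (x k) (x l)) (x m)" if "distinct [k, l, m]" for k l m
    by (rule indiscernible_meet_le[OF ind anti min ij le that])
  \<comment> \<open>The dual terms are again indiscernible, and the dual of \<open>le'\<close> is
    the inequality that \<open>indiscernible_meet_le\<close> requires of them.\<close>
  have "term_le (Meet (dual_term (x k)) (dual_term (x l))) (dual_term (x m))"
    if "distinct [k, l, m]" for k l m
    using indiscernible_dual[OF ind] _ minimal_term_dual[OF min] ij' _ that
  proof (rule indiscernible_meet_le)
    show "i \<noteq> j \<Longrightarrow> \<not> term_le (dual_term (x i)) (dual_term (x j))" for i j
      using anti[of j i] by (simp add: dual_term_le_iff)
    show "term_le (Meet (dual_term (x 0)) (dual_term (x i')))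
      (Join (Meet (dual_term (x 0)) (dual_term (x 1))) (Meet (dual_term (x 0)) (dual_term (x j'))))"
      using dual_term_le[OF le'] by simp
  qed
  then have join: "term_le (x m) (Join (x k) (x l))" if "distinct [k, l, m]" for k l m
    using that dual_term_le_iff[of "Join (x k) (x l)" "x m"] by simp
  \<comment> \<open>Semidistributivity puts \<open>x 1\<close> under
    \<open>Join (x 0) (Meet (x 1) (x 2))\<close>, which collapses to \<open>x 0\<close>.\<close>
  have "term_equiv (Join (x 0) (x 1)) (Join (x 0) (x 2))"
    using join[of 0 1 2] join[of 0 2 1] unfolding term_equiv_def Join_le_iff
    by (auto intro: term_le.join_upper1)
  from join_semidistributive[OF this]
  have "term_le (x 1) (Join (x 0) (Meet (x 1) (x 2)))" by (simp add: Join_le_iff)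
  moreover have "term_le (Join (x 0) (Meet (x 1) (x 2))) (x 0)"
    using meet[of 1 2 0] by (simp add: Join_le_iff term_le.refl)
  ultimately show False using anti[of 1 0] term_le.trans by auto
qed

section \<open>Extracting an indiscernible sequence\<close>

text \<open>The kernel \<open>C\<close> is a largest set of coordinates that are constant on an
  uncountable subfamily. Each value at a coordinate outside \<open>C\<close> then occurs only
  countably often there, so finitely many earlier values can always be avoided.\<close>

lemma sunflower_sequence:
  fixes \<sigma> :: "'i \<Rightarrow> 'k \<Rightarrow> 's"
  assumes unc: "uncountable I" and V: "finite V"
  shows "\<exists>C. \<exists>e :: nat \<Rightarrow> 'i. range e \<subseteq> I \<and> inj e \<and>
    (\<forall>i j. \<forall>k\<in>C. \<sigma> (e i) k = \<sigma> (e j) k) \<and>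
    (\<forall>i j. i < j \<longrightarrow> (\<forall>k\<in>V - C. \<forall>k'\<in>V. \<sigma> (e j) k \<noteq> \<sigma> (e i) k'))"
proof -
  let ?J = "\<lambda>C p. {i\<in>I. \<forall>k\<in>C. \<sigma> i k = p k}"
  define P where "P C \<longleftrightarrow> C \<subseteq> V \<and> (\<exists>p. uncountable (?J C p))" for C
  have "P {}" using unc by (simp add: P_def)
  moreover have "\<forall>C. P C \<longrightarrow> card C < Suc (card V)"
    using V by (auto simp: P_def less_Suc_eq_le intro: card_mono)
  ultimately have "\<exists>C. P C \<and> (\<forall>D. P D \<longrightarrow> card D \<le> card C)"
    by (rule Lattices_Big.ex_has_greatest_nat)
  then obtain C where PC: "P C" and max: "\<And>D. P D \<Longrightarrow> card D \<le> card C" by blast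
  from PC obtain p where C: "C \<subseteq> V" and "uncountable (?J C p)"
    unfolding P_def by (elim exE conjE)
  define J where "J = ?J C p"
  have J: "uncountable J" using \<open>uncountable (?J C p)\<close> by (simp add: J_def)
  \<comment> \<open>Otherwise fixing the value \<open>s\<close> at \<open>k\<close> too would make
    \<open>insert k C\<close> a larger candidate.\<close>
  have cnt: "countable {i\<in>J. \<sigma> i k = s}" if k: "k \<in> V - C" for k s
  proof (rule ccontr)
    assume u: "\<not> ?thesis"
    have "{i\<in>J. \<sigma> i k = s} = ?J (insert k C) (p(k := s))"
      using k by (auto simp: J_def split: if_splits)
    with u have "uncountable (?J (insert k C) (p(k := s)))" by simp
    then have "\<exists>q. uncountable (?J (insert k C) q)" by (intro exI[of _ "p(k := s)"])
    with k C have "P (insert k C)" unfolding P_def by (intro conjI) auto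
    from max[OF this] k show False using finite_subset[of C V] C V by simp
  qed
  \<comment> \<open>Entries outside the kernel must avoid all entries of earlier indices, kernel
    entries included.\<close>
  define fresh where "fresh B i \<longleftrightarrow> i \<in> J \<and> i \<notin> B \<and>
    (\<forall>b\<in>B. \<forall>k\<in>V - C. \<forall>k'\<in>V. \<sigma> i k \<noteq> \<sigma> b k')" for B i
  have ex: "\<exists>i. fresh B i" if B: "finite B" for B
  proof -
    \<comment> \<open>\<open>?X\<close> covers the indices of \<open>J\<close> that are not fresh;
      it is countable while \<open>J\<close> is not.\<close>
    let ?X = "B \<union> (\<Union>b\<in>B. \<Union>k\<in>V - C. \<Union>k'\<in>V. {i\<in>J. \<sigma> i k = \<sigma> b k'})"
    have "countable B" "countable V" "countable (V - C)"
      using B V by (simp_all add: countable_finite)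
    then have X: "countable ?X" by (intro countable_Un countable_UN cnt)
    have "\<not> J \<subseteq> ?X"
    proof
      assume "J \<subseteq> ?X"
      then have "countable J" using X by (rule countable_subset)
      with J show False by (rule notE)
    qed
    then obtain i where "i \<in> J" "i \<notin> ?X" by (meson subsetI)
    then show ?thesis by (intro exI[of _ i]) (auto simp: fresh_def)
  qed
  have "\<exists>e. \<forall>n::nat. fresh (e ` {..<n}) (e n)"
  proof (rule dependent_wellorder_choice)
    fix r :: 'i and f g :: "nat \<Rightarrow> 'i" and n :: nat
    assume "\<And>y. y < n \<Longrightarrow> f y = g y"
    then have "f ` {..<n} = g ` {..<n}" by (intro image_cong) auto
    then show "fresh (f ` {..<n}) r = fresh (g ` {..<n}) r" by simp
  next
    fix n :: nat and f :: "nat \<Rightarrow> 'i"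
    show "\<exists>r. fresh (f ` {..<n}) r" by (rule ex) simp
  qed
  then obtain e where fr: "\<And>n::nat. fresh (e ` {..<n}) (e n)" by blast
  note fresh_e = fr[unfolded fresh_def]
  note e = fresh_e[THEN conjunct1] fresh_e[THEN conjunct2, THEN conjunct1]
    fresh_e[THEN conjunct2, THEN conjunct2]
  have "inj e"
  proof (rule injI)
    fix m n assume "e m = e n"
    then show "m = n"
      using e(2)[of m] e(2)[of n] imageI[of m "{..<n}" e] imageI[of n "{..<m}" e]
      by (cases m n rule: linorder_cases) simp_all
  qed
  moreover have "range e \<subseteq> I" "\<forall>i j. \<forall>k\<in>C. \<sigma> (e i) k = \<sigma> (e j) k"
    using e(1) by (auto simp: J_def)
  moreover have "\<forall>i j. i < j \<longrightarrow> (\<forall>k\<in>V - C. \<forall>k'\<in>V. \<sigma> (e j) k \<noteq> \<sigma> (e i) k')"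
    using e(3) by simp
  ultimately show ?thesis by (intro exI[of _ C] exI[of _ e] conjI)
qed

text \<open>\<open>\<sigma> i\<close> names the variables of the shape \<open>u\<close>. A name from
  outside \<open>C\<close> determines both its index and its variable, so it can be moved to index
  \<open>r i\<close>; a kernel name is common to all indices and stays fixed.\<close>

lemma indiscernible_map:
  assumes inj: "\<And>i. inj_on (\<sigma> i) (gens u)"
    and const: "\<And>i j k. k \<in> C \<Longrightarrow> \<sigma> i k = \<sigma> j k"
    and disj: "\<And>i j k k'. i < j \<Longrightarrow> k \<in> gens u - C \<Longrightarrow> k' \<in> gens u \<Longrightarrow> \<sigma> j k \<noteq> \<sigma> i k'"
  shows "indiscernible (\<lambda>i. map_lat_term (\<sigma> i) u)"
  unfolding indiscernible_def
proof
  fix r :: "nat \<Rightarrow> nat"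
  let ?V = "gens u"
  \<comment> \<open>For \<open>i < j\<close> the place of \<open>k'\<close> matters: in the kernel,
    \<open>const\<close> moves both names to one index and injectivity decides; outside it,
    \<open>disj\<close> applies with the roles of \<open>k\<close> and \<open>k'\<close>
    exchanged.\<close>
  have sep: "i = j \<and> k = k'" if "\<sigma> i k = \<sigma> j k'" "k \<in> ?V - C" "k' \<in> ?V" for i j k k'
  proof (cases i j rule: linorder_cases)
    case less
    show ?thesis
    proof (cases "k' \<in> C")
      case True
      with that const[OF True, of j i] inj_onD[OF inj[of i], of k k'] show ?thesis by auto
    next
      case False
      with that disj[OF less, of k' k] show ?thesis by auto
    qed
  next
    case equal
    with that inj_onD[OF inj[of i], of k k'] show ?thesis by auto
  next
    case greater
    with that disj[OF greater, of k k'] show ?thesis by auto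
  qed
  let ?D = "UNIV \<times> (?V - C)" and ?\<phi> = "\<lambda>(i, k). \<sigma> i k"
  have inj\<phi>: "inj_on ?\<phi> ?D" using sep by (auto simp: inj_on_def)
  define \<theta> where "\<theta> s = (if s \<in> ?\<phi> ` ?D then (\<lambda>(i, k). \<sigma> (r i) k) (inv_into ?D ?\<phi> s) else s)" for s
  have "\<theta> (\<sigma> i k) = \<sigma> (r i) k" if k: "k \<in> ?V" for i k
  proof (cases "k \<in> C")
    case True
    have "\<sigma> i k \<notin> ?\<phi> ` ?D"
    proof
      assume "\<sigma> i k \<in> ?\<phi> ` ?D"
      then obtain j k' where "\<sigma> j k' = \<sigma> i k" "k' \<in> ?V - C" by auto
      with sep[of j k' i k] k True show False by auto
    qed
    then show ?thesis using const[OF True] by (simp add: \<theta>_def)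
  next
    case False
    then have "(i, k) \<in> ?D" using k by simp
    from inv_into_f_f[OF inj\<phi> this] imageI[OF this, of ?\<phi>] show ?thesis by (simp add: \<theta>_def)
  qed
  then show "\<exists>\<theta>. \<forall>i. map_lat_term \<theta> (map_lat_term (\<sigma> i) u) = map_lat_term (\<sigma> (r i)) u"
    by (intro exI[of _ \<theta>]) (auto simp: lat_term.map_comp intro: lat_term.map_cong)
qed

text \<open>Numbering the generators of a term splits it into a shape over \<open>nat\<close> and an
  injective naming. Uncountably many terms share a shape, and a sunflower among their namings gives
  the sequence.\<close>

lemma uncountable_indiscernible:
  fixes N :: "'s lat_term set"
  assumes N: "uncountable N"
  shows "\<exists>x. indiscernible x \<and> range x \<subseteq> N \<and> inj x"
proof -
  define shape :: "'s lat_term \<Rightarrow> nat lat_term"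
    where "shape t = map_lat_term (to_nat_on (gens t)) t" for t
  define \<sigma> :: "'s lat_term \<Rightarrow> nat \<Rightarrow> 's" where "\<sigma> t = from_nat_into (gens t)" for t
  have cnt: "countable (gens t)" for t :: "'s lat_term"
    by (rule countable_finite[OF finite_gens])
  have shape: "map_lat_term (\<sigma> t) (shape t) = t" for t
  proof -
    have "map_lat_term (\<sigma> t) (shape t) = map_lat_term (\<lambda>s. s) t"
      unfolding shape_def \<sigma>_def lat_term.map_comp
      by (rule lat_term.map_cong) (auto simp: cnt)
    then show ?thesis by (simp add: lat_term.map_ident)
  qed
  have inj: "inj_on (\<sigma> t) (gens (shape t))" for t
    unfolding shape_def \<sigma>_def lat_term.set_map by (rule inj_onI) (auto simp: cnt)
  obtain u where u: "uncountable {t\<in>N. shape t = u}"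
  proof (rule ccontr)
    assume "\<not> thesis"
    then have "countable {t\<in>N. shape t = u}" for u using that by blast
    then have "countable (\<Union>u. {t\<in>N. shape t = u})" by (intro countable_UN) auto
    moreover have "(\<Union>u. {t\<in>N. shape t = u}) = N" by auto
    ultimately show False using N by simp
  qed
  obtain C and e :: "nat \<Rightarrow> 's lat_term" where e: "range e \<subseteq> {t\<in>N. shape t = u}" "inj e"
    and const: "\<forall>i j. \<forall>k\<in>C. \<sigma> (e i) k = \<sigma> (e j) k"
    and disj: "\<forall>i j. i < j \<longrightarrow> (\<forall>k\<in>gens u - C. \<forall>k'\<in>gens u. \<sigma> (e j) k \<noteq> \<sigma> (e i) k')"
    using sunflower_sequence[OF u finite_gens[of u], of \<sigma>] by (elim exE conjE)
  have sh: "shape (e i) = u" for i using e(1) by auto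
  have "indiscernible (\<lambda>i. map_lat_term (\<sigma> (e i)) u)"
  proof (rule indiscernible_map)
    show "inj_on (\<sigma> (e i)) (gens u)" for i using inj[of "e i"] by (simp add: sh)
    show "\<sigma> (e i) k = \<sigma> (e j) k" if "k \<in> C" for i j k
      by (rule const[rule_format, OF that])
    show "\<sigma> (e j) k \<noteq> \<sigma> (e i) k'" if "i < j" "k \<in> gens u - C" "k' \<in> gens u" for i j k k'
      by (rule disj[rule_format, OF that])
  qed
  moreover have "(\<lambda>i. map_lat_term (\<sigma> (e i)) u) = e"
    using shape[of "e _"] by (intro ext) (simp only: sh)
  moreover have "range e \<subseteq> N" using e(1) by auto
  ultimately show ?thesis using e(2) by (intro exI[of _ e]) simp
qed

section \<open>Locally finite sublattices\<close>

text \<open>The generating set is gone: closure is stated for every term whose class is in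
  \<open>M\<close>, so shortest representatives can be used freely.\<close>

lemma countable_locally_finite_terms:
  fixes M :: "'s free_lat set"
  assumes join: "\<And>t u. abs_free_lat t \<in> M \<Longrightarrow> abs_free_lat u \<in> M \<Longrightarrow> abs_free_lat (Join t u) \<in> M"
    and meet: "\<And>t u. abs_free_lat t \<in> M \<Longrightarrow> abs_free_lat u \<in> M \<Longrightarrow> abs_free_lat (Meet t u) \<in> M"
    and fin: "\<And>a b. a \<in> M \<Longrightarrow> b \<in> M \<Longrightarrow> finite {c\<in>M. free_le a c \<and> free_le c b}"
  shows "countable M"
proof (rule ccontr)
  assume unc: "uncountable M"
  have "\<exists>t. abs_free_lat t = a \<and> minimal_term t" for a :: "'s free_lat"
    by (metis minimal_term_ex abs_eq Quotient_free_lat Quotient_abs_rep)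
  then obtain rep :: "'s free_lat \<Rightarrow> 's lat_term"
    where rep: "\<And>a. abs_free_lat (rep a) = a" "\<And>a. minimal_term (rep a)" by metis
  have "inj rep" by (metis rep(1) injI)
  then have "uncountable (rep ` M)"
    using unc by (simp add: countable_image_inj_eq inj_on_subset)
  then obtain x where ind: "indiscernible x" and x: "range x \<subseteq> rep ` M" and "inj x"
    using uncountable_indiscernible by blast
  have xM: "abs_free_lat (x i) \<in> M" and min: "minimal_term (x i)" for i
    using x rep by (auto simp: image_subset_iff image_iff) metis+
  have ne: "\<not> term_equiv (x i) (x j)" if "i \<noteq> j" for i j
  proof
    assume "term_equiv (x i) (x j)"
    then have "abs_free_lat (x i) = abs_free_lat (x j)" by (simp add: abs_eq)
    moreover obtain a b where "x i = rep a" "x j = rep b" using x by blast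
    ultimately show False using that \<open>inj x\<close> rep(1) by (metis injD)
  qed
  \<comment> \<open>Only indices from 2 on are compared, so that a collision in the finite interval
    avoids 0 and 1.\<close>
  have pigeon: "\<exists>i j. distinct [0, 1, i, j] \<and> term_equiv (f i) (f j)"
    if f: "\<And>i. abs_free_lat (f i) \<in> M" "\<And>i. term_le a (f i)" "\<And>i. term_le (f i) b"
      and ab: "abs_free_lat a \<in> M" "abs_free_lat b \<in> M"
    for a b :: "'s lat_term" and f :: "nat \<Rightarrow> 's lat_term"
  proof -
    have "finite ((\<lambda>i. abs_free_lat (f i)) ` {2..})"
      by (rule finite_subset[OF _ fin[OF ab]]) (use f in \<open>auto simp: free_le_abs\<close>)
    then have "\<not> inj_on (\<lambda>i. abs_free_lat (f i)) {2..}"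
      using infinite_Ici[of "2 :: nat"] finite_imageD by blast
    then obtain i j where "i \<ge> 2" "j \<ge> 2" "i \<noteq> j" "abs_free_lat (f i) = abs_free_lat (f j)"
      unfolding inj_on_def by auto
    then show ?thesis by (intro exI[of _ i] exI[of _ j]) (auto simp: abs_eq)
  qed
  obtain i j where ij: "distinct [0, 1, i, j]"
    and "term_equiv (Join (Meet (x 0) (x 1)) (Meet (x 0) (x i)))
                    (Join (Meet (x 0) (x 1)) (Meet (x 0) (x j)))"
    using pigeon[of "\<lambda>i. Join (Meet (x 0) (x 1)) (Meet (x 0) (x i))" "Meet (x 0) (x 1)" "x 0"]
    by (auto simp: join meet xM Join_le_iff term_le.join_upper1 term_le.meet_lower1)
  then have le: "term_le (Meet (x 0) (x i)) (Join (Meet (x 0) (x 1)) (Meet (x 0) (x j)))"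
    by (simp add: term_equiv_def Join_le_iff)
  \<comment> \<open>The dual family, lying between \<open>x 0\<close> and
    \<open>Join (x 0) (x 1)\<close>.\<close>
  obtain i' j' where ij': "distinct [0, 1, i', j']"
    and "term_equiv (Meet (Join (x 0) (x 1)) (Join (x 0) (x i')))
                    (Meet (Join (x 0) (x 1)) (Join (x 0) (x j')))"
    using pigeon[of "\<lambda>i. Meet (Join (x 0) (x 1)) (Join (x 0) (x i))" "x 0" "Join (x 0) (x 1)"]
    by (auto simp: join meet xM le_Meet_iff term_le.join_upper1 term_le.meet_lower1)
  then have le': "term_le (Meet (Join (x 0) (x 1)) (Join (x 0) (x j'))) (Join (x 0) (x i'))"
    by (simp add: term_equiv_def le_Meet_iff)
  show False by (rule indiscernible_contradiction[OF ind ne min ij le ij' le'])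
qed

theorem theorem3p4:
  fixes L :: "('a, 'm) gorder_scheme" and S :: "'s set"
  assumes "lattice L"
    and "\<exists>M. sublattice M (free_lattice S) \<and>
             lattice_isomorphic L ((free_lattice S)\<lparr>carrier := M\<rparr>)"
    and "locally_finite L"
  shows "countable (carrier L)"
proof -
  let ?F = "free_lattice S"
  interpret L: lattice L by fact
  interpret F: lattice ?F by (rule lattice_free_lattice)
  from assms(2) obtain M where M: "sublattice M ?F"
    and iso: "lattice_isomorphic L (?F\<lparr>carrier := M\<rparr>)" by blast
  let ?M = "?F\<lparr>carrier := M\<rparr>"
  from iso obtain g h where g: "g \<in> lattice_hom L ?M" and h: "h \<in> lattice_hom ?M L"
    and hg: "\<forall>x\<in>carrier L. h (g x) = x" and gh: "\<forall>y\<in>M. g (h y) = y"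
    unfolding lattice_isomorphic_def by auto
  have M_sub: "M \<subseteq> carrier ?F"
    and cl: "\<And>x y. x \<in> M \<Longrightarrow> y \<in> M \<Longrightarrow> x \<squnion>\<^bsub>?F\<^esub> y \<in> M \<and> x \<sqinter>\<^bsub>?F\<^esub> y \<in> M"
    using M by (auto simp: sublattice_def)
  have h_cl: "h a \<in> carrier L" if "a \<in> M" for a
    using h that by (auto simp: lattice_hom_def)
  \<comment> \<open>Homomorphisms are given by joins and meets, so the order is recovered from
    \<open>a \<squnion> b = b\<close>.\<close>
  have h_mono: "h a \<sqsubseteq>\<^bsub>L\<^esub> h b" if ab: "a \<in> M" "b \<in> M" "free_le a b" for a b
  proof -
    have le: "a \<sqsubseteq>\<^bsub>?F\<^esub> b" using ab by (simp add: free_lattice_def)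
    have "a \<in> carrier ?F" "b \<in> carrier ?F" using ab M_sub by auto
    then have "a \<squnion>\<^bsub>?F\<^esub> b = b"
      using le by (intro F.le_antisym) (auto intro: F.join_le F.join_right)
    then have "h b = h (a \<squnion>\<^bsub>?M\<^esub> b)"
      using sublattice_lattice(2)[OF lattice_free_lattice M ab(1,2)] by simp
    also have "\<dots> = h a \<squnion>\<^bsub>L\<^esub> h b"
      using h ab by (simp add: lattice_hom_def join_pres_def)
    finally show ?thesis using L.join_left[OF h_cl h_cl, of a b] ab by simp
  qed
  have "countable M"
  proof (rule countable_locally_finite_terms)
    fix t u assume "abs_free_lat t \<in> M" "abs_free_lat u \<in> M"
    \<comment> \<open>\<open>t\<close> and \<open>u\<close> may contain generators outside
      \<open>S\<close>, while \<open>join_abs\<close> and \<open>meet_abs\<close> need terms over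
      \<open>S\<close>; equivalent terms over \<open>S\<close> replace them.\<close>
    moreover from this M_sub obtain t' u' where
      t': "abs_free_lat t = abs_free_lat t'" "gens t' \<subseteq> S" and
      u': "abs_free_lat u = abs_free_lat u'" "gens u' \<subseteq> S"
      by (metis carrier_free_latticeE subsetD)
    moreover have "abs_free_lat (Join t u) = abs_free_lat (Join t' u')"
      "abs_free_lat (Meet t u) = abs_free_lat (Meet t' u')"
      using t'(1) u'(1) unfolding abs_eq term_equiv_def Join_le_iff le_Meet_iff
      by (auto intro: le_JoinI1 le_JoinI2 Meet_leI1 Meet_leI2)
    ultimately show "abs_free_lat (Join t u) \<in> M" "abs_free_lat (Meet t u) \<in> M"
      using cl[of "abs_free_lat t" "abs_free_lat u"] by (simp_all add: join_abs meet_abs)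
  next
    fix a b assume ab: "a \<in> M" "b \<in> M"
    \<comment> \<open>For comparable endpoints \<open>h\<close> embeds the interval into a finite
      one of \<open>L\<close>; otherwise it is empty by transitivity.\<close>
    show "finite {c \<in> M. free_le a c \<and> free_le c b}"
    proof (cases "free_le a b")
      case True
      have "h ` {c \<in> M. free_le a c \<and> free_le c b} \<subseteq> \<lbrace>h a..h b\<rbrace>\<^bsub>L\<^esub>"
        using ab by (auto simp: at_least_at_most_def h_cl h_mono)
      moreover have "finite (\<lbrace>h a..h b\<rbrace>\<^bsub>L\<^esub>)"
        using assms(3) ab True by (auto simp: locally_finite_def h_cl h_mono)
      moreover have "inj_on h {c \<in> M. free_le a c \<and> free_le c b}"
        using gh by (auto intro!: inj_on_inverseI[of _ g])
      ultimately show ?thesis by (meson finite_imageD finite_subset)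
    next
      case False
      then have "{c \<in> M. free_le a c \<and> free_le c b} = {}" by (auto intro: free_le_trans)
      then show ?thesis by (simp only: finite.emptyI)
    qed
  qed
  moreover have "inj_on g (carrier L)" using hg by (auto intro!: inj_on_inverseI[of _ h])
  moreover have "g ` carrier L \<subseteq> M" using g by (auto simp: lattice_hom_def)
  ultimately show ?thesis by (meson countable_image_inj_on countable_subset)
qed

end
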